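(* Let $(\mathbf{x}_t,\mathbf{z}_t,\mathbf{y}_t)_{t\ge1}$ be generated by OADM with $\eta=0$ (defined in the context), let assumptions (a)–(e) of the context hold, and assume that $A$ is a square invertible matrix; let $\lambda_{\min}^{A}>0$ be the smallest eigenvalue of $AA^T$ and $\lambda_{\max}^{B}>0$ the largest eigenvalue of $B^TB$. Let $\hat{\mathbf{x}}_t$ be defined by $A\hat{\mathbf{x}}_t+B\mathbf{z}_t=\mathbf{c}$. Given the horizon $T\ge1$, set $\rho=\frac{G_f\sqrt{T}}{D_{\mathbf{z}}\sqrt{\lambda_{\min}^{A}\lambda_{\max}^{B}}}$. Then $$R_2(T)\le\frac{G_fD_{\mathbf{z}}\sqrt{\lambda_{\max}^{B}}}{\sqrt{\lambda_{\min}^{A}}}\sqrt{T},\qquad R^c(T)\le\lambda_{\max}^{B}D_{\mathbf{z}}^2+\frac{2FD_{\mathbf{z}}\sqrt{\lambda_{\min}^{A}\lambda_{\max}^{B}\,T}}{G_f},$$ where $$R_2(T)=\sum_{t=1}^T\big(f_t(\hat{\mathbf{x}}_t)+g(\mathbf{z}_t)\big)-\min_{\mathbf{z}\in\mathcal{Z},\,A\mathbf{x}+B\mathbf{z}=\mathbf{c}}\sum_{t=1}^T\big(f_t(\mathbf{x})+g(\mathbf{z})\big),$$ $$R^c(T)=\sum_{t=1}^T\Big(\|A\mathbf{x}_{t+1}+B\mathbf{z}_{t+1}-\mathbf{c}\|_2^2+\|B\mathbf{z}_{t+1}-B\mathbf{z}_t\|_2^2\Big).$$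
   Context: Setting: $\mathcal{Z}\subset\mathbb{R}^{n_2}$ is a convex set, $A\in\mathbb{R}^{m\times n_1}$, $B\in\mathbb{R}^{m\times n_2}$, $\mathbf{c}\in\mathbb{R}^m$ are fixed, $f_1,f_2,\dots:\mathbb{R}^{n_1}\to\mathbb{R}$ are convex and $g:\mathbb{R}^{n_2}\to\mathbb{R}\cup\{+\infty\}$ is closed, proper, convex. A pair $(\mathbf{x}^*,\mathbf{z}^* )\in\mathbb{R}^{n_1}\times\mathcal{Z}$ is feasible if $A\mathbf{x}^*+B\mathbf{z}^*=\mathbf{c}$; feasible pairs exist. OADM with $\eta=0$ and parameter $\rho>0$: for $t\ge1$, $$\mathbf{x}_{t+1}\in\operatorname{argmin}_{\mathbf{x}\in\mathbb{R}^{n_1}}\{f_t(\mathbf{x})+\langle\mathbf{y}_t,A\mathbf{x}+B\mathbf{z}_t-\mathbf{c}\rangle+\tfrac{\rho}{2}\|A\mathbf{x}+B\mathbf{z}_t-\mathbf{c}\|_2^2\},$$ $$\mathbf{z}_{t+1}\in\operatorname{argmin}_{\mathbf{z}\in\mathcal{Z}}\{g(\mathbf{z})+\langle\mathbf{y}_t,A\mathbf{x}_{t+1}+B\mathbf{z}-\mathbf{c}\rangle+\tfrac{\rho}{2}\|A\mathbf{x}_{t+1}+B\mathbf{z}-\mathbf{c}\|_2^2\},$$ $$\mathbf{y}_{t+1}=\mathbf{y}_t+\rho(A\mathbf{x}_{t+1}+B\mathbf{z}_{t+1}-\mathbf{c}),$$ the minimizers being assumed to exist. Assumptions. (a) $\|f_t'(\mathbf{x})\|_2\le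 G_f$ for every $t$, every $\mathbf{x}$ and every $f_t'(\mathbf{x})\in\partial f_t(\mathbf{x})$. (b) $B_\phi(\mathbf{u},\mathbf{v})=\phi(\mathbf{u})-\phi(\mathbf{v})-\langle\nabla\phi(\mathbf{v}),\mathbf{u}-\mathbf{v}\rangle$ is a Bregman divergence with $B_\phi(\mathbf{u},\mathbf{v})\ge\frac{\alpha}{2}\|\mathbf{u}-\mathbf{v}\|_2^2$, $\alpha>0$ (it does not enter the updates because $\eta=0$). (c) $\mathbf{x}_1=\mathbf{0}$, $\mathbf{y}_1=\mathbf{0}$, $\mathbf{z}_1=\mathbf{0}\in\mathcal{Z}$, and every feasible pair $(\mathbf{x}^*,\mathbf{z}^* )$ satisfies $B_\phi(\mathbf{x}^*,\mathbf{x}_1)\le D_{\mathbf{x}}^2$ and $\|\mathbf{z}^*-\mathbf{z}_1\|_2\le D_{\mathbf{z}}$. (d) $g(\mathbf{z}_1)=0$ and $g(\mathbf{z})\ge0$ for all $\mathbf{z}$. (e) There is a constant $F>0$ such that $f_t(\mathbf{x}_{t+1})+g(\mathbf{z}_{t+1})-(f_t(\mathbf{x}^* )+g(\mathbf{z}^* ))\ge-F$ for every $t$ and every feasible $(\mathbf{x}^*,\mathbf{z}^* )$. The constants $G_f,D_{\mathbf z}$ are positive. *)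

theory Defs
  imports "HOL-Analysis.Analysis"
begin

definition subdifferential :: "('a::real_inner \<Rightarrow> real) \<Rightarrow> 'a \<Rightarrow> 'a set" where
  "subdifferential f x = {d. \<forall>u. f u \<ge> f x + d \<bullet> (u - x)}"

(* The library's epigraph and convex_on only cover real-valued functions. *)
definition ereal_epigraph :: "('a \<Rightarrow> ereal) \<Rightarrow> ('a \<times> real) set" where
  "ereal_epigraph g = {(z, r). g z \<le> ereal r}"

definition closed_proper_convex :: "('a::real_normed_vector \<Rightarrow> ereal) \<Rightarrow> bool" where
  "closed_proper_convex g \<longleftrightarrow>
     closed (ereal_epigraph g) \<and> convex (ereal_epigraph g) \<and>
     (\<forall>z. g z \<noteq> -\<infinity>) \<and> (\<exists>z. g z \<noteq> \<infinity>)"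

(* dphi plays the role of the gradient of phi. *)
definition bregman :: "('a::real_inner \<Rightarrow> real) \<Rightarrow> ('a \<Rightarrow> 'a) \<Rightarrow> 'a \<Rightarrow> 'a \<Rightarrow> real" where
  "bregman phi dphi u v = phi u - phi v - dphi v \<bullet> (u - v)"

definition eigenvalue :: "real^'n^'n \<Rightarrow> real \<Rightarrow> bool" where
  "eigenvalue M k \<longleftrightarrow> (\<exists>v. v \<noteq> 0 \<and> M *v v = k *\<^sub>R v)"

(* The next two are only meaningful for matrices that have a real eigenvalue;
   they are applied to A A^T and B^T B, which are symmetric. *)
definition min_eigenvalue :: "real^'n^'n \<Rightarrow> real" where
  "min_eigenvalue M = (LEAST k. eigenvalue M k)"

definition max_eigenvalue :: "real^'n^'n \<Rightarrow> real" where
  "max_eigenvalue M = (GREATEST k. eigenvalue M k)"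

definition feasible_pairs ::
  "real^'n1^'m \<Rightarrow> real^'n2^'m \<Rightarrow> real^'m \<Rightarrow> (real^'n2) set \<Rightarrow> ((real^'n1) \<times> (real^'n2)) set" where
  "feasible_pairs A B c Z = {(x, z). z \<in> Z \<and> A *v x + B *v z = c}"

(* Online alternating direction method without proximal term (eta = 0).
   Rounds are numbered from 1; the values at index 0 are irrelevant. *)
definition oadm ::
  "real^'n1^'m \<Rightarrow> real^'n2^'m \<Rightarrow> real^'m \<Rightarrow> (real^'n2) set \<Rightarrow>
   (nat \<Rightarrow> real^'n1 \<Rightarrow> real) \<Rightarrow> (real^'n2 \<Rightarrow> ereal) \<Rightarrow> real \<Rightarrow>
   (nat \<Rightarrow> real^'n1) \<Rightarrow> (nat \<Rightarrow> real^'n2) \<Rightarrow> (nat \<Rightarrow> real^'m) \<Rightarrow> bool" where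
  "oadm A B c Z f g \<rho> x z y \<longleftrightarrow> (\<forall>t\<ge>1.
     is_arg_min
       (\<lambda>u. f t u + y t \<bullet> (A *v u + B *v z t - c) + \<rho> / 2 * (norm (A *v u + B *v z t - c))\<^sup>2)
       (\<lambda>u. u \<in> UNIV) (x (t + 1)) \<and>
     is_arg_min
       (\<lambda>w. g w + ereal (y t \<bullet> (A *v x (t + 1) + B *v w - c)
                       + \<rho> / 2 * (norm (A *v x (t + 1) + B *v w - c))\<^sup>2))
       (\<lambda>w. w \<in> Z) (z (t + 1)) \<and>
     y (t + 1) = y t + \<rho> *\<^sub>R (A *v x (t + 1) + B *v z (t + 1) - c))"

(* The benchmark is the infimum over the feasible pairs, which is the minimum
   whenever the minimum is attained (Z need not be closed). *)
definition regret2 ::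
  "real^'n1^'m \<Rightarrow> real^'n2^'m \<Rightarrow> real^'m \<Rightarrow> (real^'n2) set \<Rightarrow>
   (nat \<Rightarrow> real^'n1 \<Rightarrow> real) \<Rightarrow> (real^'n2 \<Rightarrow> ereal) \<Rightarrow>
   (nat \<Rightarrow> real^'n1) \<Rightarrow> (nat \<Rightarrow> real^'n2) \<Rightarrow> nat \<Rightarrow> ereal" where
  "regret2 A B c Z f g xhat z T =
     (\<Sum>t=1..T. ereal (f t (xhat t)) + g (z t)) -
     (INF (u, w) \<in> feasible_pairs A B c Z. \<Sum>t=1..T. ereal (f t u) + g w)"

definition constraint_regret ::
  "real^'n1^'m \<Rightarrow> real^'n2^'m \<Rightarrow> real^'m \<Rightarrow>
   (nat \<Rightarrow> real^'n1) \<Rightarrow> (nat \<Rightarrow> real^'n2) \<Rightarrow> nat \<Rightarrow> real" where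
  "constraint_regret A B c x z T =
     (\<Sum>t=1..T. (norm (A *v x (t + 1) + B *v z (t + 1) - c))\<^sup>2
              + (norm (B *v z (t + 1) - B *v z t))\<^sup>2)"

end

(* The optimality conditions of the two argmin steps, combined with the multiplier update, give
   for every feasible pair (u, w), with w in the domain of g,

     f t (x (t+1)) + g (z (t+1)) - (f t u + g w) + \<rho>/2 |A x (t+1) + B z t - c|^2
       <= P t - P (t+1),   P t = |y t|^2 / (2 \<rho>) + \<rho>/2 |B w - B z t|^2.

   Since A (x (t+1) - xhat t) = A x (t+1) + B z t - c, replacing x (t+1) by xhat t costs at most
   Gf / sqrt lamA times the norm of this residual; by AM-GM its square is absorbed by the left-hand
   side. Summing gives the regret bound. For the constraint bound, the objective difference is at
   least -F, and monotonicity of the subdifferential of g makes the summands of the constraint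
   regret at most the squared residual |A x (t+1) + B z t - c|^2. *)

theory Submission
  imports Defs
begin

section \<open>Extreme eigenvalues of symmetric matrices\<close>

text \<open>Dividing by \<theta> and letting it tend to 0 from the right removes the quadratic term.
  This first-order condition serves both the Rayleigh quotient and the penalized
  minimizations.\<close>

lemma nonneg_linear_coefficient:
  fixes a b :: real
  assumes "\<And>\<theta>. 0 < \<theta> \<Longrightarrow> \<theta> \<le> 1 \<Longrightarrow> 0 \<le> \<theta> * a + \<theta>\<^sup>2 * b"
  shows "0 \<le> a"
proof (rule tendsto_lowerbound)
  show "((\<lambda>\<theta>. a + \<theta> * b) \<longlongrightarrow> a) (at_right 0)"
    by (rule tendsto_eq_intros refl | simp)+
  show "\<forall>\<^sub>F \<theta> in at_right 0. 0 \<le> a + \<theta> * b"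
    unfolding eventually_at_right_field
  proof (intro exI[of _ "1::real"] conjI allI impI)
    fix \<theta> :: real assume *: "0 < \<theta>" "\<theta> < 1"
    then have "0 \<le> \<theta> * (a + \<theta> * b)"
      using assms[of \<theta>] by (simp add: algebra_simps power2_eq_square)
    then show "0 \<le> a + \<theta> * b" using * by (simp add: zero_le_mult_iff)
  qed simp
qed simp

text \<open>The Rayleigh quotient attains its minimum over the unit sphere at an eigenvector.\<close>

lemma symmetric_min_eigenvalue:
  fixes M :: "real^'n^'n"
  assumes "transpose M = M"
  shows "eigenvalue M (min_eigenvalue M)"
    and "min_eigenvalue M * (norm v)\<^sup>2 \<le> v \<bullet> (M *v v)"
proof -
  have sym: "u \<bullet> (M *v w) = w \<bullet> (M *v u)" for u w
    by (metis assms dot_lmul_matrix inner_commute vector_transpose_matrix)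
  let ?S = "sphere (0::real^'n) 1"
  have "continuous_on ?S (\<lambda>u. u \<bullet> (M *v u))"
    by (intro continuous_intros linear_continuous_on linear_conv_bounded_linear[THEN iffD1]) simp
  moreover have "?S \<noteq> {}"
    by simp
  ultimately obtain p where p: "norm p = 1" and
    min: "\<And>u. norm u = 1 \<Longrightarrow> p \<bullet> (M *v p) \<le> u \<bullet> (M *v u)"
    using continuous_attains_inf[of ?S "\<lambda>u. u \<bullet> (M *v u)"] by auto
  define k where "k = p \<bullet> (M *v p)"
  have bound: "k * (norm u)\<^sup>2 \<le> u \<bullet> (M *v u)" for u
  proof (cases "u = 0")
    case False
    then have "k \<le> (u /\<^sub>R norm u) \<bullet> (M *v (u /\<^sub>R norm u))"
      unfolding k_def by (intro min) simp
    also have "\<dots> = (u \<bullet> (M *v u)) / (norm u)\<^sup>2"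
      by (simp add: scaleR_matrix_vector_assoc[symmetric] matrix_vector_mult_scaleR
          power2_eq_square divide_inverse)
    finally show ?thesis using False by (simp add: field_simps)
  qed simp
  let ?w = "M *v p - k *\<^sub>R p"
  \<comment> \<open>The quadratic form of \<open>M - k I\<close> is nonnegative and vanishes at \<open>p\<close>,
    so its derivative at \<open>p\<close> in the direction \<open>-?w\<close> is nonnegative.\<close>
  have "0 \<le> - 2 * (norm ?w)\<^sup>2"
  proof (rule nonneg_linear_coefficient)
    fix \<theta> :: real
    have "k * (norm (p - \<theta> *\<^sub>R ?w))\<^sup>2 \<le> (p - \<theta> *\<^sub>R ?w) \<bullet> (M *v (p - \<theta> *\<^sub>R ?w))"
      by (rule bound)
    then have "0 \<le> (p - \<theta> *\<^sub>R ?w) \<bullet> (M *v (p - \<theta> *\<^sub>R ?w)) - k * (norm (p - \<theta> *\<^sub>R ?w))\<^sup>2"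
      by simp
    also have "(norm (p - \<theta> *\<^sub>R ?w))\<^sup>2 = 1 - 2 * \<theta> * (?w \<bullet> p) + \<theta>\<^sup>2 * (norm ?w)\<^sup>2"
      using p unfolding power2_norm_eq_inner norm_eq_1
      by (simp add: inner_diff_left inner_diff_right inner_commute power2_eq_square algebra_simps)
    also have "(p - \<theta> *\<^sub>R ?w) \<bullet> (M *v (p - \<theta> *\<^sub>R ?w))
        = k - 2 * \<theta> * (?w \<bullet> (M *v p)) + \<theta>\<^sup>2 * (?w \<bullet> (M *v ?w))"
      using sym[of p ?w]
      by (simp only: k_def matrix_vector_mult_diff_distrib matrix_vector_mult_scaleR
          inner_diff_left inner_diff_right inner_scaleR_left inner_scaleR_right)
        (simp add: power2_eq_square algebra_simps)
    also have "k - 2 * \<theta> * (?w \<bullet> (M *v p)) + \<theta>\<^sup>2 * (?w \<bullet> (M *v ?w))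
        - k * (1 - 2 * \<theta> * (?w \<bullet> p) + \<theta>\<^sup>2 * (norm ?w)\<^sup>2)
        = \<theta> * (- 2 * (?w \<bullet> (M *v p) - k * (?w \<bullet> p))) + \<theta>\<^sup>2 * (?w \<bullet> (M *v ?w) - k * (norm ?w)\<^sup>2)"
      by (simp add: algebra_simps)
    also have "?w \<bullet> (M *v p) - k * (?w \<bullet> p) = (norm ?w)\<^sup>2"
      by (simp add: power2_norm_eq_inner inner_diff_right)
    finally show "0 \<le> \<theta> * (- 2 * (norm ?w)\<^sup>2) + \<theta>\<^sup>2 * (?w \<bullet> (M *v ?w) - k * (norm ?w)\<^sup>2)" .
  qed
  \<comment> \<open>The inequality forces \<open>?w\<close> to vanish, so \<open>p\<close> is an
    eigenvector for \<open>k\<close>.\<close>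
  then have eig: "eigenvalue M k"
    using p unfolding eigenvalue_def by (intro exI[of _ p]) auto
  moreover have "k \<le> l" if "eigenvalue M l" for l
  proof -
    from that obtain u where "u \<noteq> 0" "M *v u = l *\<^sub>R u" unfolding eigenvalue_def by blast
    with bound[of u] show ?thesis by (simp add: power2_norm_eq_inner)
  qed
  ultimately have "min_eigenvalue M = k"
    unfolding min_eigenvalue_def by (intro Least_equality)
  with eig bound show "eigenvalue M (min_eigenvalue M)"
    and "min_eigenvalue M * (norm v)\<^sup>2 \<le> v \<bullet> (M *v v)" by simp_all
qed

lemma eigenvalue_uminus: "eigenvalue (- M) (- k) \<longleftrightarrow> eigenvalue M k"
proof -
  have "(- M) *v v = - (M *v v)" for v
    by (simp add: vec_eq_iff matrix_vector_mult_def sum_negf)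
  then show ?thesis unfolding eigenvalue_def by simp
qed

text \<open>Negating the matrix negates its eigenvalues and its quadratic form, which reduces the
  claim to the smallest eigenvalue.\<close>

lemma symmetric_max_eigenvalue:
  fixes M :: "real^'n^'n"
  assumes "transpose M = M"
  shows "v \<bullet> (M *v v) \<le> max_eigenvalue M * (norm v)\<^sup>2"
proof -
  have neg: "(- M) *v w = - (M *v w)" for w
    by (simp add: vec_eq_iff matrix_vector_mult_def sum_negf)
  have sym: "transpose (- M) = - M"
    using assms by (simp add: transpose_def vec_eq_iff)
  have least: "min_eigenvalue (- M) \<le> k" if ev: "eigenvalue (- M) k" for k
  proof -
    from ev obtain u where u: "u \<noteq> 0" "(- M) *v u = k *\<^sub>R u" unfolding eigenvalue_def by blast
    with symmetric_min_eigenvalue(2)[OF sym, of u] show ?thesis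
      by (simp add: power2_norm_eq_inner)
  qed
  have "max_eigenvalue M = - min_eigenvalue (- M)"
    unfolding max_eigenvalue_def
  proof (rule Greatest_equality)
    show "eigenvalue M (- min_eigenvalue (- M))"
      using symmetric_min_eigenvalue(1)[OF sym] eigenvalue_uminus[of M "- min_eigenvalue (- M)"]
      by simp
    show "k \<le> - min_eigenvalue (- M)" if "eigenvalue M k" for k
      using least[of "- k"] that by (simp add: eigenvalue_uminus)
  qed
  with symmetric_min_eigenvalue(2)[OF sym, of v] show ?thesis
    by (simp add: neg)
qed

lemma norm_matrix_vector_le_max_eigenvalue:
  fixes B :: "real^'n^'m"
  shows "(norm (B *v v))\<^sup>2 \<le> max_eigenvalue (transpose B ** B) * (norm v)\<^sup>2"
proof -
  have "v \<bullet> ((transpose B ** B) *v v) = (norm (B *v v))\<^sup>2"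
    by (metis dot_lmul_matrix matrix_vector_mul_assoc power2_norm_eq_inner vector_transpose_matrix
        transpose_transpose inner_commute)
  then show ?thesis
    using symmetric_max_eigenvalue[of "transpose B ** B" v] by (simp add: matrix_transpose_mul)
qed

text \<open>The smallest eigenvalue of A A^T directly bounds |A^T w| from below, not |A u|. To pass
  to A, write u = A^T w; then |u|^2 = w . (A u) is at most |w| |A u|, and |w| is controlled by
  |u|.\<close>

lemma invertible_min_eigenvalue:
  fixes A :: "real^'n^'m"
  assumes "invertible A"
  shows "min_eigenvalue (A ** transpose A) > 0" (is "?l > 0")
    and "min_eigenvalue (A ** transpose A) * (norm u)\<^sup>2 \<le> (norm (A *v u))\<^sup>2"
proof -
  obtain C where C: "A ** C = mat 1" "C ** A = mat 1"
    using assms unfolding invertible_def by blast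
  have Ct: "transpose C *v (transpose A *v v) = v" "transpose A *v (transpose C *v w) = w" for v w
    using C by (simp_all only: matrix_vector_mul_assoc matrix_transpose_mul[symmetric]
        transpose_mat matrix_vector_mul_lid)
  have sym: "transpose (A ** transpose A) = A ** transpose A"
    by (simp add: matrix_transpose_mul)
  have quad: "v \<bullet> ((A ** transpose A) *v v) = (norm (transpose A *v v))\<^sup>2" for v
    by (metis dot_lmul_matrix matrix_vector_mul_assoc power2_norm_eq_inner vector_transpose_matrix
        transpose_transpose inner_commute)
  obtain p where p: "p \<noteq> 0" "(A ** transpose A) *v p = ?l *\<^sub>R p"
    using symmetric_min_eigenvalue(1)[OF sym] unfolding eigenvalue_def by blast
  have "transpose A *v p \<noteq> 0" using p(1) Ct(1)[of p] by auto
  then have "0 < ?l * (norm p)\<^sup>2"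
    using quad[of p] by (simp add: p power2_norm_eq_inner)
  then show pos: "?l > 0" using p(1) by (simp add: zero_less_mult_iff)
  show "?l * (norm u)\<^sup>2 \<le> (norm (A *v u))\<^sup>2"
  proof (cases "u = 0")
    case False
    define w where "w = transpose C *v u"
    have u: "transpose A *v w = u" unfolding w_def by (rule Ct)
    have w: "?l * (norm w)\<^sup>2 \<le> (norm u)\<^sup>2"
      using symmetric_min_eigenvalue(2)[OF sym, of w] unfolding quad u .
    have "(norm u)\<^sup>2 = w \<bullet> (A *v u)"
      by (metis dot_lmul_matrix power2_norm_eq_inner u vector_transpose_matrix transpose_transpose)
    also have "\<dots> \<le> norm w * norm (A *v u)" by (rule norm_cauchy_schwarz)
    finally have "((norm u)\<^sup>2)\<^sup>2 \<le> (norm w * norm (A *v u))\<^sup>2" by (intro power_mono) auto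
    then have "?l * ((norm u)\<^sup>2)\<^sup>2 \<le> ?l * (norm w)\<^sup>2 * (norm (A *v u))\<^sup>2"
      using pos by (simp add: power_mult_distrib)
    also have "\<dots> \<le> (norm u)\<^sup>2 * (norm (A *v u))\<^sup>2" by (intro mult_right_mono w) simp
    finally have "(norm u)\<^sup>2 * (?l * (norm u)\<^sup>2) \<le> (norm u)\<^sup>2 * (norm (A *v u))\<^sup>2"
      by (simp add: power2_eq_square[of "(norm u)\<^sup>2"] mult_ac)
    then show ?thesis using False by simp
  qed simp
qed

section \<open>Subgradients and optimality conditions for convex functions\<close>

text \<open>A hyperplane separates (x, f x) from the strict epigraph. It is not vertical because f
  is finite everywhere, so rescaling its normal by the last coordinate yields a subgradient.\<close>

lemma subdifferential_nonempty:
  fixes f :: "'a::euclidean_space \<Rightarrow> real"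
  assumes "convex_on UNIV f"
  shows "subdifferential f x \<noteq> {}"
proof -
  define S where "S = {(u, r). f u < r}"
  have conv: "convex S"
    unfolding convex_alt
  proof (intro ballI allI impI)
    fix p q and \<theta> :: real assume *: "p \<in> S" "q \<in> S" "0 \<le> \<theta> \<and> \<theta> \<le> 1"
    obtain u r w s where pq: "p = (u, r)" "q = (w, s)" "f u < r" "f w < s"
      using * unfolding S_def by auto
    have "f ((1 - \<theta>) *\<^sub>R u + \<theta> *\<^sub>R w) \<le> (1 - \<theta>) * f u + \<theta> * f w"
      using * by (intro convex_onD[OF assms]) auto
    also have "\<dots> < (1 - \<theta>) * r + \<theta> * s"
    \<comment> \<open>Strictness comes from \<open>f w < s\<close> when \<theta> is positive and
      from \<open>f u < r\<close> when it is 0.\<close>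
    proof (cases "\<theta> = 0")
      case False
      then have "\<theta> * f w < \<theta> * s" "(1 - \<theta>) * f u \<le> (1 - \<theta>) * r"
        using * pq by (auto intro: mult_left_mono)
      then show ?thesis by linarith
    qed (simp add: pq)
    finally show "(1 - \<theta>) *\<^sub>R p + \<theta> *\<^sub>R q \<in> S" by (simp add: pq S_def)
  qed
  have "(x, f x + 1) \<in> S" "(x, f x) \<notin> S" by (simp_all add: S_def)
  then have "S \<noteq> {}" "{(x, f x)} \<inter> S = {}" by auto
  then obtain a b where ab: "a \<noteq> 0" "a \<bullet> (x, f x) \<le> b" "\<And>p. p \<in> S \<Longrightarrow> b \<le> a \<bullet> p"
    using separating_hyperplane_sets[of "{(x, f x)}" S] conv by (metis convex_singleton insert_not_empty insertI1)
  obtain d e where a: "a = (d, e)" by (cases a)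
  have sep: "d \<bullet> x + e * f x \<le> d \<bullet> u + e * r" if "f u < r" for u r
    using ab(2) ab(3)[of "(u, r)"] that by (simp add: a S_def)
  have "0 \<le> e" using sep[of x "f x + 1"] by (simp add: algebra_simps)
  moreover have "e \<noteq> 0"
  proof
    assume e: "e = 0"
    \<comment> \<open>For a vertical hyperplane \<open>sep\<close> says that x minimizes the linear
      form d; moving by -d contradicts this unless d = 0.\<close>
    have "d \<bullet> x \<le> d \<bullet> (x - d)"
      using sep[of "x - d" "f (x - d) + 1"] by (simp add: e)
    then have "d = 0"
      by (simp add: inner_diff_right) (metis inner_gt_zero_iff not_less)
    then show False using ab(1) a e by (simp add: zero_prod_def)
  qed
  ultimately have e: "e > 0" by simp
  \<comment> \<open>The strict epigraph only offers heights above \<open>f u\<close>, hence the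
    detour through \<epsilon>.\<close>
  have "f x + (- (1 / e) *\<^sub>R d) \<bullet> (u - x) \<le> f u" for u
  proof (rule field_le_epsilon)
    fix \<epsilon> :: real assume "0 < \<epsilon>"
    then show "f x + (- (1 / e) *\<^sub>R d) \<bullet> (u - x) \<le> f u + \<epsilon>"
      using sep[of u "f u + \<epsilon>"] e by (simp add: field_simps inner_diff_right)
  qed
  then show ?thesis unfolding subdifferential_def by blast
qed

text \<open>Compare p with the points of the segment from p to u. Convexity bounds the change of h
  linearly in \<theta>, and the penalty adds a linear term plus a term in the square of \<theta>,
  which drops out in the limit. The vector \<open>y + \<rho> *\<^sub>R (M *v p + b)\<close> is the
  gradient of the penalty with respect to the image M w, taken at w = p.\<close>

lemma quadratic_penalty_minimizer:
  fixes h :: "real^'n \<Rightarrow> real" and M :: "real^'n^'m" and b y :: "real^'m"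
  assumes conv: "convex_on S h" and p: "p \<in> S" and u: "u \<in> S"
    and min: "\<And>w. w \<in> S \<Longrightarrow>
      h p + (y \<bullet> (M *v p + b) + \<rho> / 2 * (norm (M *v p + b))\<^sup>2)
      \<le> h w + (y \<bullet> (M *v w + b) + \<rho> / 2 * (norm (M *v w + b))\<^sup>2)"
  shows "h p \<le> h u + (y + \<rho> *\<^sub>R (M *v p + b)) \<bullet> (M *v u - M *v p)"
proof -
  define r d where "r = M *v p + b" and "d = M *v u - M *v p"
  have "0 \<le> h u - h p + (y + \<rho> *\<^sub>R r) \<bullet> d"
  proof (rule nonneg_linear_coefficient)
    fix \<theta> :: real assume \<theta>: "0 < \<theta>" "\<theta> \<le> 1"
    define w where "w = (1 - \<theta>) *\<^sub>R p + \<theta> *\<^sub>R u"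
    have "w \<in> S"
      unfolding w_def using \<theta> p u convex_on_imp_convex[OF conv] by (simp add: convex_alt)
    have Mw: "M *v w + b = r + \<theta> *\<^sub>R d"
      by (simp add: w_def r_def d_def matrix_vector_right_distrib matrix_vector_mult_scaleR
          algebra_simps)
    have "h w \<le> (1 - \<theta>) * h p + \<theta> * h u"
      unfolding w_def using \<theta> p u by (intro convex_onD[OF conv]) auto
    moreover have "h p + (y \<bullet> r + \<rho> / 2 * (norm r)\<^sup>2)
        \<le> h w + (y \<bullet> (r + \<theta> *\<^sub>R d) + \<rho> / 2 * (norm (r + \<theta> *\<^sub>R d))\<^sup>2)"
      using min[OF \<open>w \<in> S\<close>] unfolding Mw r_def .
    moreover have "(norm (r + \<theta> *\<^sub>R d))\<^sup>2 = (norm r)\<^sup>2 + 2 * \<theta> * (r \<bullet> d) + \<theta>\<^sup>2 * (norm d)\<^sup>2"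
      unfolding power2_norm_eq_inner
      by (simp add: inner_simps inner_commute[of d r] power2_eq_square algebra_simps)
    ultimately show "0 \<le> \<theta> * (h u - h p + (y + \<rho> *\<^sub>R r) \<bullet> d) + \<theta>\<^sup>2 * (\<rho> / 2 * (norm d)\<^sup>2)"
      by (simp add: inner_simps algebra_simps)
  qed
  then show ?thesis by (simp add: r_def d_def)
qed

text \<open>Passing to real values on the part of Z where g is finite makes
  \<open>quadratic_penalty_minimizer\<close> applicable to the z-update. Convexity of the epigraph
  is applied to the graph points over p and q.\<close>

lemma convex_on_real_of_ereal:
  fixes g :: "'a::real_normed_vector \<Rightarrow> ereal"
  assumes "closed_proper_convex g" and "convex Z" and "\<And>w. 0 \<le> g w"
  shows "convex_on {w \<in> Z. g w \<noteq> \<infinity>} (\<lambda>w. real_of_ereal (g w))"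
proof -
  let ?D = "{w \<in> Z. g w \<noteq> \<infinity>}"
  have fin: "ereal (real_of_ereal (g w)) = g w" if "w \<in> ?D" for w
    using assms(3)[of w] that by (simp add: ereal_real)
  \<comment> \<open>Keeping the left side extended-valued lets the same inequality show that the
    domain is convex: the real right side forces finiteness.\<close>
  have *: "g ((1 - \<theta>) *\<^sub>R p + \<theta> *\<^sub>R q)
      \<le> ereal ((1 - \<theta>) * real_of_ereal (g p) + \<theta> * real_of_ereal (g q))"
    if "p \<in> ?D" "q \<in> ?D" "0 \<le> \<theta>" "\<theta> \<le> 1" for p q \<theta>
  proof -
    have "(p, real_of_ereal (g p)) \<in> ereal_epigraph g" "(q, real_of_ereal (g q)) \<in> ereal_epigraph g"
      using fin[OF that(1)] fin[OF that(2)] by (auto simp: ereal_epigraph_def)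
    moreover have "convex (ereal_epigraph g)" using assms(1) by (simp add: closed_proper_convex_def)
    ultimately have "(1 - \<theta>) *\<^sub>R (p, real_of_ereal (g p)) + \<theta> *\<^sub>R (q, real_of_ereal (g q)) \<in> ereal_epigraph g"
      using that(3,4) unfolding convex_alt by blast
    then show ?thesis by (simp add: ereal_epigraph_def)
  qed
  have "convex ?D"
    unfolding convex_alt
  proof (intro ballI allI impI)
    fix p q and \<theta> :: real assume pq: "p \<in> ?D" "q \<in> ?D" "0 \<le> \<theta> \<and> \<theta> \<le> 1"
    then have "(1 - \<theta>) *\<^sub>R p + \<theta> *\<^sub>R q \<in> Z" using assms(2) by (simp add: convex_alt)
    then show "(1 - \<theta>) *\<^sub>R p + \<theta> *\<^sub>R q \<in> ?D" using *[of p q \<theta>] pq by auto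
  qed
  then show ?thesis
  proof (intro convex_onI)
    fix \<theta> :: real and p q assume "0 < \<theta>" "\<theta> < 1" "p \<in> ?D" "q \<in> ?D"
    then have "g ((1 - \<theta>) *\<^sub>R p + \<theta> *\<^sub>R q)
      \<le> ereal ((1 - \<theta>) * real_of_ereal (g p) + \<theta> * real_of_ereal (g q))"
      by (intro *) auto
    then show "real_of_ereal (g ((1 - \<theta>) *\<^sub>R p + \<theta> *\<^sub>R q))
      \<le> (1 - \<theta>) * real_of_ereal (g p) + \<theta> * real_of_ereal (g q)"
      using assms(3) by (metis real_of_ereal_le_0 real_of_ereal_ord_simps(1)
        real_of_ereal.simps(1) real_of_ereal_positive_mono ereal_less_eq(3) PInfty_neq_ereal(1))
  qed
qed

section \<open>The potential identity and the two bounds for OADM\<close>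

text \<open>Read a as A x (t+1) - c, b and b' as B z t and B z (t+1), and s as B w, so that -s is A
  u - c for a feasible (u, w). The left side is then the sum of the linear terms of the two
  optimality conditions. Expanding squares turns it into the drop of the potential minus the squared
  residual.\<close>

lemma oadm_potential_identity:
  fixes a b b' s y :: "'a::real_inner"
  assumes "\<rho> \<noteq> 0"
  defines "y' \<equiv> y + \<rho> *\<^sub>R (a + b')"
  shows "(y + \<rho> *\<^sub>R (a + b)) \<bullet> (- s - a) + y' \<bullet> (s - b') =
    ((norm y)\<^sup>2 / (2 * \<rho>) + \<rho> / 2 * (norm (s - b))\<^sup>2)
    - ((norm y')\<^sup>2 / (2 * \<rho>) + \<rho> / 2 * (norm (s - b'))\<^sup>2) - \<rho> / 2 * (norm (a + b))\<^sup>2"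
  using assms(1) unfolding y'_def power2_norm_eq_inner
  by (simp add: inner_simps inner_commute field_simps)

theorem theorem8:
  fixes A :: "real^'n1^'m" and B :: "real^'n2^'m" and c :: "real^'m"
    and Z :: "(real^'n2) set"
    and f :: "nat \<Rightarrow> real^'n1 \<Rightarrow> real" and g :: "real^'n2 \<Rightarrow> ereal"
    and phi :: "real^'n1 \<Rightarrow> real" and dphi :: "real^'n1 \<Rightarrow> real^'n1"
    and x xhat :: "nat \<Rightarrow> real^'n1" and z :: "nat \<Rightarrow> real^'n2" and y :: "nat \<Rightarrow> real^'m"
    and \<rho> \<alpha> Gf Dx Dz F lamA lamB :: real and T :: nat
  assumes Z_convex: "convex Z"
    and f_convex: "\<And>t. t \<ge> 1 \<Longrightarrow> convex_on UNIV (f t)"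
    and g_cpc: "closed_proper_convex g"
    and feasible_ex: "feasible_pairs A B c Z \<noteq> {}"
    and oadm: "oadm A B c Z f g \<rho> x z y"
    and Gf_pos: "Gf > 0" and Dz_pos: "Dz > 0"
    and subgrad_bound:
      "\<And>t u d. t \<ge> 1 \<Longrightarrow> d \<in> subdifferential (f t) u \<Longrightarrow> norm d \<le> Gf"
    and phi_grad: "\<And>v. GDERIV phi v :> dphi v"
    and alpha_pos: "\<alpha> > 0"
    and bregman_bound: "\<And>u v. bregman phi dphi u v \<ge> \<alpha> / 2 * (norm (u - v))\<^sup>2"
    and init: "x 1 = 0" "y 1 = 0" "z 1 = 0" "0 \<in> Z"
    and Dx_bound: "\<And>xs zs. (xs, zs) \<in> feasible_pairs A B c Z \<Longrightarrow> bregman phi dphi xs (x 1) \<le> Dx\<^sup>2"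
    and Dz_bound: "\<And>xs zs. (xs, zs) \<in> feasible_pairs A B c Z \<Longrightarrow> norm (zs - z 1) \<le> Dz"
    and g_init: "g (z 1) = 0" and g_nonneg: "\<And>w. g w \<ge> 0"
    and F_pos: "F > 0"
    and F_bound:
      "\<And>t xs zs. t \<ge> 1 \<Longrightarrow> (xs, zs) \<in> feasible_pairs A B c Z \<Longrightarrow>
         ereal (f t (x (t + 1))) + g (z (t + 1)) - (ereal (f t xs) + g zs) \<ge> ereal (- F)"
    and A_square: "CARD('n1) = CARD('m)" and A_inv: "invertible A"
    and lamA_def: "lamA = min_eigenvalue (A ** transpose A)"
    and lamB_def: "lamB = max_eigenvalue (transpose B ** B)" and lamB_pos: "lamB > 0"
    and xhat: "\<And>t. t \<ge> 1 \<Longrightarrow> A *v xhat t + B *v z t = c"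
    and T_ge: "T \<ge> 1"
    and rho: "\<rho> = Gf * sqrt (real T) / (Dz * sqrt (lamA * lamB))"
  shows "regret2 A B c Z f g xhat z T \<le> ereal (Gf * Dz * sqrt lamB / sqrt lamA * sqrt (real T)) \<and>
         constraint_regret A B c x z T \<le>
           lamB * Dz\<^sup>2 + 2 * F * Dz * sqrt (lamA * lamB * real T) / Gf"
proof -
  \<comment> \<open>\<open>real_of_ereal\<close> sends infinity to 0, so \<open>G\<close> represents
    g on \<open>D\<close> only.\<close>
  define G where "G w = real_of_ereal (g w)" for w
  define D where "D = {w \<in> Z. g w \<noteq> \<infinity>}"
  define s where "s t = (norm (A *v x (t + 1) + B *v z t - c))\<^sup>2" for t
  have G_fin: "g w = ereal (G w)" if "w \<in> D" for w
    using g_nonneg[of w] that by (auto simp: G_def D_def ereal_real)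
  have G_nonneg: "0 \<le> G w" for w
    using g_nonneg[of w] by (simp add: G_def real_of_ereal_pos)
  have G_convex: "convex_on D G"
    unfolding G_def D_def using g_cpc Z_convex g_nonneg by (rule convex_on_real_of_ereal)
  have zero_D: "0 \<in> D" and G_zero: "G 0 = 0"
    using g_init init by (simp_all add: D_def G_def)

  obtain C where C: "A ** C = mat 1"
    using A_inv unfolding invertible_def by blast
  have solve: "A *v (C *v v) = v" for v
    by (simp add: matrix_vector_mul_assoc C)
  \<comment> \<open>As A is onto, every w in Z belongs to a feasible pair, so the bound assumed for
    such pairs holds on all of Z.\<close>
  have Z_bound: "norm w \<le> Dz" if "w \<in> Z" for w
    using Dz_bound[of "C *v (c - B *v w)" w] that init by (simp add: feasible_pairs_def solve)
  have lamA_pos: "lamA > 0" and lamA: "\<And>u. lamA * (norm u)\<^sup>2 \<le> (norm (A *v u))\<^sup>2"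
    unfolding lamA_def using invertible_min_eigenvalue[OF A_inv] by auto
  have lamB: "(norm (B *v w))\<^sup>2 \<le> lamB * (norm w)\<^sup>2" for w
    unfolding lamB_def by (rule norm_matrix_vector_le_max_eigenvalue)
  have rho_pos: "\<rho> > 0"
    unfolding rho using Gf_pos Dz_pos lamA_pos lamB_pos T_ge by simp

  have x_min: "f t (x (t + 1)) + (y t \<bullet> (A *v x (t + 1) + (B *v z t - c))
        + \<rho> / 2 * (norm (A *v x (t + 1) + (B *v z t - c)))\<^sup>2)
      \<le> f t u + (y t \<bullet> (A *v u + (B *v z t - c)) + \<rho> / 2 * (norm (A *v u + (B *v z t - c)))\<^sup>2)"
    and z_min: "z (t + 1) \<in> Z \<and> (w \<in> Z \<longrightarrow>
      g (z (t + 1)) + ereal (y t \<bullet> (A *v x (t + 1) + B *v z (t + 1) - c)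
        + \<rho> / 2 * (norm (A *v x (t + 1) + B *v z (t + 1) - c))\<^sup>2)
      \<le> g w + ereal (y t \<bullet> (A *v x (t + 1) + B *v w - c)
        + \<rho> / 2 * (norm (A *v x (t + 1) + B *v w - c))\<^sup>2))"
    and y_step: "y (t + 1) = y t + \<rho> *\<^sub>R (A *v x (t + 1) + B *v z (t + 1) - c)"
    if "t \<ge> 1" for t u w
    using oadm that unfolding oadm_def is_arg_min_linorder by (auto simp: add.assoc add_diff_eq)

  \<comment> \<open>After the first round, comparison of the minimizer with the point 0, where g is
    finite, shows that g is finite at \<open>z t\<close>.\<close>
  have z_D: "z t \<in> D" if t: "t \<ge> 1" for t
  proof (cases "t = 1")
    case False
    with t obtain r where r: "t = r + 1" "r \<ge> 1" by (cases t) auto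
    then show ?thesis
      using z_min[OF r(2), of 0] G_fin[OF zero_D] zero_D by (auto simp: D_def)
  qed (use zero_D init in simp)

  have x_opt: "f t (x (t + 1)) \<le> f t u
      + (y t + \<rho> *\<^sub>R (A *v x (t + 1) - c + B *v z t)) \<bullet> (A *v u - A *v x (t + 1))"
    if t: "t \<ge> 1" for t u
    using quadratic_penalty_minimizer[OF f_convex[OF t] _ _ x_min[OF t], of u]
    by (simp add: algebra_simps)
  \<comment> \<open>Here the multiplier produced by the penalty is exactly \<open>y (t + 1)\<close>;
    in \<open>x_opt\<close> it still contains \<open>z t\<close>.\<close>
  have z_opt: "G (z (t + 1)) \<le> G w + y (t + 1) \<bullet> (B *v w - B *v z (t + 1))"
    if t: "t \<ge> 1" and w: "w \<in> D" for t w
  proof -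
    have "G (z (t + 1)) \<le> G w
      + (y t + \<rho> *\<^sub>R (B *v z (t + 1) + (A *v x (t + 1) - c))) \<bullet> (B *v w - B *v z (t + 1))"
    proof (rule quadratic_penalty_minimizer[OF G_convex])
      fix v assume v: "v \<in> D"
      then have "v \<in> Z" by (simp add: D_def)
      with z_min[OF t, of v] G_fin[OF v] G_fin[OF z_D[of "t + 1"]]
      show "G (z (t + 1)) + (y t \<bullet> (B *v z (t + 1) + (A *v x (t + 1) - c))
          + \<rho> / 2 * (norm (B *v z (t + 1) + (A *v x (t + 1) - c)))\<^sup>2)
        \<le> G v + (y t \<bullet> (B *v v + (A *v x (t + 1) - c))
          + \<rho> / 2 * (norm (B *v v + (A *v x (t + 1) - c)))\<^sup>2)"
        by (simp add: add_diff_eq add.commute[of "B *v v"] add.commute[of "B *v z (Suc t)"])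
    qed (use z_D w in auto)
    moreover have "B *v z (t + 1) + (A *v x (t + 1) - c) = A *v x (t + 1) + B *v z (t + 1) - c"
      by simp
    ultimately show ?thesis unfolding y_step[OF t] by (simp only:)
  qed

  define P where "P w t = (norm (y t))\<^sup>2 / (2 * \<rho>) + \<rho> / 2 * (norm (B *v w - B *v z t))\<^sup>2" for w t
  have P_nonneg: "0 \<le> P w t" for w t using rho_pos by (simp add: P_def)
  \<comment> \<open>Since \<open>y 1\<close> and \<open>z 1\<close> vanish, only the term with B w
    survives.\<close>
  have P_init: "P w 1 \<le> \<rho> / 2 * (lamB * Dz\<^sup>2)" if "w \<in> Z" for w
  proof -
    have "lamB * (norm w)\<^sup>2 \<le> lamB * Dz\<^sup>2"
      using lamB_pos Z_bound[OF that] by (simp add: power_mono)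
    then show ?thesis using lamB[of w] rho_pos init by (simp add: P_def)
  qed
  have step: "f t (x (t + 1)) + G (z (t + 1)) - (f t u + G w) + \<rho> / 2 * s t \<le> P w t - P w (t + 1)"
    if t: "t \<ge> 1" and w: "w \<in> D" and feas: "A *v u + B *v w = c" for t u w
  proof -
    have u: "A *v u = c - B *v w" using feas by (simp add: algebra_simps)
    have "f t (x (t + 1)) + G (z (t + 1)) - (f t u + G w) \<le>
      (y t + \<rho> *\<^sub>R (A *v x (t + 1) - c + B *v z t)) \<bullet> (A *v u - A *v x (t + 1))
      + y (t + 1) \<bullet> (B *v w - B *v z (t + 1))"
      using x_opt[OF t, of u] z_opt[OF t w] by simp
    also have "\<dots> = P w t - P w (t + 1) - \<rho> / 2 * s t"
    proof -
      let ?a = "A *v x (t + 1) - c"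
      have "A *v u - A *v x (t + 1) = - (B *v w) - ?a" by (simp add: u)
      moreover have "y (t + 1) = y t + \<rho> *\<^sub>R (?a + B *v z (t + 1))"
        unfolding y_step[OF t] by (simp only: diff_add_eq)
      moreover have "s t = (norm (?a + B *v z t))\<^sup>2"
        by (simp only: s_def diff_add_eq)
      ultimately show ?thesis
        using oadm_potential_identity[of \<rho> "y t" ?a "B *v z t" "B *v w" "B *v z (t + 1)"] rho_pos
        by (simp only: P_def)
    qed
    finally show ?thesis by simp
  qed
  have telescope: "(\<Sum>t=1..T. q t - q (t + 1)) = q 1 - q (T + 1)" for q :: "nat \<Rightarrow> real"
    using T_ge sum_Suc_diff[of 1 T "\<lambda>t. - q t"] by simp

  have regret: "(\<Sum>t=1..T. f t (xhat t) + G (z t)) - (\<Sum>t=1..T. f t u + G w)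
      \<le> Gf * Dz * sqrt lamB / sqrt lamA * sqrt (real T)"
    if w: "w \<in> D" and feas: "A *v u + B *v w = c" for u w
  proof -
    \<comment> \<open>The regret evaluates g at \<open>z t\<close>, but \<open>step\<close> at
      \<open>z (t + 1)\<close>. The shift is a second telescoping sum, whose total is at most 0
      because \<open>G\<close> is nonnegative and vanishes at \<open>z 1\<close>.\<close>
    have each: "f t (xhat t) + G (z t) - (f t u + G w)
      \<le> (P w t - P w (t + 1)) + (G (z t) - G (z (t + 1))) + Gf\<^sup>2 / (2 * \<rho> * lamA)"
      if t: "t \<in> {1..T}" for t
    proof -
      from t have t1: "t \<ge> 1" by simp
      obtain d where d: "d \<in> subdifferential (f t) (xhat t)"
        using subdifferential_nonempty[OF f_convex[OF t1]] by blast
      let ?e = "norm (x (t + 1) - xhat t)"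
      have "f t (xhat t) - f t (x (t + 1)) \<le> - (d \<bullet> (x (t + 1) - xhat t))"
        using d[unfolded subdifferential_def, simplified, rule_format, of "x (t + 1)"] by simp
      also have "\<dots> \<le> norm d * ?e"
        using Cauchy_Schwarz_ineq2[of d "x (t + 1) - xhat t"] by linarith
      also have "\<dots> \<le> Gf * ?e" by (intro mult_right_mono subgrad_bound[OF t1 d]) simp
      \<comment> \<open>AM-GM, weighted so that the quadratic term is at most
        \<open>\<rho> / 2 * s t\<close>, the amount supplied by \<open>step\<close>.\<close>
      also have "Gf * ?e \<le> Gf\<^sup>2 / (2 * \<rho> * lamA) + \<rho> / 2 * (lamA * ?e\<^sup>2)"
      proof -
        have "0 \<le> (Gf - \<rho> * lamA * ?e)\<^sup>2 / (2 * \<rho> * lamA)" using rho_pos lamA_pos by simp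
        also have "\<dots> = Gf\<^sup>2 / (2 * \<rho> * lamA) + \<rho> / 2 * (lamA * ?e\<^sup>2) - Gf * ?e"
          using rho_pos lamA_pos by (simp add: field_simps power2_eq_square)
        finally show ?thesis by simp
      qed
      also have "lamA * ?e\<^sup>2 \<le> s t"
      proof -
        have "A *v xhat t = c - B *v z t" using xhat[OF t1] by (simp add: algebra_simps)
        then have "A *v (x (t + 1) - xhat t) = A *v x (t + 1) + B *v z t - c"
          by (simp add: matrix_vector_mult_diff_distrib)
        with lamA[of "x (t + 1) - xhat t"] show ?thesis by (simp add: s_def)
      qed
      finally have "f t (xhat t) - f t (x (t + 1)) \<le> Gf\<^sup>2 / (2 * \<rho> * lamA) + \<rho> / 2 * s t"
        using rho_pos by simp
      with step[OF t1 w feas] show ?thesis by linarith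
    qed
    have "(\<Sum>t=1..T. f t (xhat t) + G (z t)) - (\<Sum>t=1..T. f t u + G w)
      = (\<Sum>t=1..T. f t (xhat t) + G (z t) - (f t u + G w))"
      by (rule sum_subtractf[symmetric])
    also have "\<dots> \<le> (\<Sum>t=1..T. (P w t - P w (t + 1)) + (G (z t) - G (z (t + 1))) + Gf\<^sup>2 / (2 * \<rho> * lamA))"
      by (intro sum_mono each)
    also have "\<dots> = (P w 1 - P w (T + 1)) + (G (z 1) - G (z (T + 1))) + T * (Gf\<^sup>2 / (2 * \<rho> * lamA))"
      using telescope[of "P w"] telescope[of "\<lambda>t. G (z t)"] by (simp add: sum.distrib)
    also have "\<dots> \<le> \<rho> / 2 * (lamB * Dz\<^sup>2) + T * (Gf\<^sup>2 / (2 * \<rho> * lamA))"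
      using P_init[of w] w P_nonneg[of w "T + 1"] G_nonneg[of "z (T + 1)"] G_zero init
      by (simp add: D_def)
    \<comment> \<open>The choice of \<rho> balances the two terms: each equals half of the bound.
      Naming the square roots leaves a rational identity.\<close>
    also have "\<dots> = Gf * Dz * sqrt lamB / sqrt lamA * sqrt (real T)"
    proof -
      define a b \<tau> where ab: "a = sqrt lamA" "b = sqrt lamB" "\<tau> = sqrt (real T)"
      have sq: "lamA = a * a" "lamB = b * b" "real T = \<tau> * \<tau>" and "a > 0" "b > 0" "\<tau> > 0"
        using lamA_pos lamB_pos T_ge by (simp_all add: ab)
      then show ?thesis
        unfolding rho real_sqrt_mult ab[symmetric] unfolding sq using Gf_pos Dz_pos
        by (simp add: field_simps power2_eq_square)
    qed
    finally show ?thesis .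
  qed

  let ?K = "Gf * Dz * sqrt lamB / sqrt lamA * sqrt (real T)"
  let ?R = "\<Sum>t=1..T. f t (xhat t) + G (z t)"
  \<comment> \<open>A real lower bound valid for every feasible pair bounds the infimum, whether or
    not it is attained.\<close>
  have "ereal (?R - ?K) \<le> (INF (u, w) \<in> feasible_pairs A B c Z. \<Sum>t=1..T. ereal (f t u) + g w)"
  proof (rule INF_greatest, clarify)
    fix u w assume "(u, w) \<in> feasible_pairs A B c Z"
    then have w: "w \<in> Z" "A *v u + B *v w = c" by (auto simp: feasible_pairs_def)
    show "ereal (?R - ?K) \<le> (\<Sum>t=1..T. ereal (f t u) + g w)"
    proof (cases "w \<in> D")
      case True
      then show ?thesis using regret[OF True w(2)] by (simp add: G_fin)
    next
      case False
      then have "g w = \<infinity>" using w by (simp add: D_def)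
      \<comment> \<open>The sum is nonempty because T is at least 1, so one infinite value of g
        makes it infinite.\<close>
      then have "(\<Sum>t=1..T. ereal (f t u) + g w) = \<infinity>"
        using T_ge by (subst sum_Pinfty) auto
      then show ?thesis by simp
    qed
  qed
  moreover have "(\<Sum>t=1..T. ereal (f t (xhat t)) + g (z t)) = ereal ?R"
    by (simp add: G_fin z_D)
  ultimately have "regret2 A B c Z f g xhat z T \<le> ereal ?R - ereal (?R - ?K)"
    unfolding regret2_def by (simp add: ereal_minus_mono del: ereal_minus)
  then have first: "regret2 A B c Z f g xhat z T \<le> ereal ?K" by simp

  \<comment> \<open>Monotonicity of the subdifferential of \<open>g\<close> on \<open>Z\<close>; in the first round
    \<open>y 1 = 0\<close> is a subgradient because \<open>z 1\<close> minimizes \<open>g\<close>.\<close>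
  have mono: "(A *v x (t + 1) + B *v z (t + 1) - c) \<bullet> (B *v z (t + 1) - B *v z t) \<le> 0"
    if t: "t \<ge> 1" for t
  proof -
    have "G (z t) \<le> G (z (t + 1)) + y t \<bullet> (B *v z (t + 1) - B *v z t)"
    proof (cases "t = 1")
      case True
      then show ?thesis using init G_zero G_nonneg by simp
    next
      case False
      with t obtain r where "t = r + 1" "r \<ge> 1" by (cases t) auto
      then show ?thesis using z_opt[of r "z (t + 1)"] z_D[of "t + 1"] by simp
    qed
    moreover have "G (z (t + 1)) \<le> G (z t) + y (t + 1) \<bullet> (B *v z t - B *v z (t + 1))"
      using z_opt[OF t z_D[OF t]] .
    moreover have "\<rho> * ((A *v x (t + 1) + B *v z (t + 1) - c) \<bullet> (B *v z (t + 1) - B *v z t))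
        = (y (t + 1) - y t) \<bullet> (B *v z (t + 1) - B *v z t)"
      by (simp only: y_step[OF t] add_diff_cancel_left' inner_scaleR_left)
    ultimately have "\<rho> * ((A *v x (t + 1) + B *v z (t + 1) - c) \<bullet> (B *v z (t + 1) - B *v z t)) \<le> 0"
      by (simp only: inner_diff_left inner_diff_right)
    then show ?thesis using rho_pos by (simp add: mult_le_0_iff)
  qed
  \<comment> \<open>The residual with the old \<open>z t\<close> is \<open>?r - ?d\<close>; by
    \<open>mono\<close>, the cross term in its expanded square has the favourable sign.\<close>
  have split: "(norm (A *v x (t + 1) + B *v z (t + 1) - c))\<^sup>2 + (norm (B *v z (t + 1) - B *v z t))\<^sup>2 \<le> s t"
    if t: "t \<ge> 1" for t
  proof -
    let ?r = "A *v x (t + 1) + B *v z (t + 1) - c" and ?d = "B *v z (t + 1) - B *v z t"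
    have "s t = (norm (?r - ?d))\<^sup>2" by (simp add: s_def algebra_simps)
    also have "\<dots> = (norm ?r)\<^sup>2 + (norm ?d)\<^sup>2 - 2 * (?r \<bullet> ?d)"
      unfolding dot_norm_neg by (simp add: diff_divide_distrib add_divide_distrib)
    finally show ?thesis using mono[OF t] by simp
  qed
  have s_le: "s t \<le> 2 / \<rho> * (P 0 t - P 0 (t + 1)) + 2 / \<rho> * F" if t: "t \<ge> 1" for t
  proof -
    \<comment> \<open>The pair (u, 0) is feasible and the same in every round, so the potentials
      \<open>P 0\<close> telescope.\<close>
    define u where "u = C *v c"
    have u: "A *v u + B *v 0 = c" by (simp add: u_def solve)
    have "ereal (- F) \<le> ereal (f t (x (t + 1))) + g (z (t + 1)) - (ereal (f t u) + g 0)"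
      using u init by (intro F_bound[OF t]) (simp add: feasible_pairs_def)
    then have "- F \<le> f t (x (t + 1)) + G (z (t + 1)) - (f t u + G 0)"
      using z_D[of "t + 1"] by (simp add: G_fin zero_D)
    with step[OF t zero_D u] have "\<rho> / 2 * s t \<le> (P 0 t - P 0 (t + 1)) + F" by simp
    then show ?thesis using rho_pos by (simp add: field_simps)
  qed
  have "constraint_regret A B c x z T \<le> (\<Sum>t=1..T. 2 / \<rho> * (P 0 t - P 0 (t + 1)) + 2 / \<rho> * F)"
    unfolding constraint_regret_def by (intro sum_mono order_trans[OF split s_le]) auto
  also have "\<dots> = 2 / \<rho> * (P 0 1 - P 0 (T + 1)) + T * (2 / \<rho> * F)"
    by (simp only: sum.distrib sum_distrib_left[symmetric] telescope) simp
  also have "\<dots> \<le> 2 / \<rho> * (\<rho> / 2 * (lamB * Dz\<^sup>2)) + T * (2 / \<rho> * F)"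
    using P_init[of 0] init P_nonneg[of 0 "T + 1"] rho_pos
    by (intro add_right_mono mult_left_mono) auto
  \<comment> \<open>The factor \<rho> cancels in the first term. In the second, T / \<rho> is of
    order sqrt T because \<rho> itself grows like sqrt T.\<close>
  also have "\<dots> = lamB * Dz\<^sup>2 + 2 * F * Dz * sqrt (lamA * lamB * real T) / Gf"
  proof -
    define \<tau> l where \<tau>: "\<tau> = sqrt (real T)" and l: "l = sqrt (lamA * lamB)"
    have T: "real T = \<tau> * \<tau>" and "\<tau> > 0" "l > 0"
      using lamA_pos lamB_pos T_ge by (simp_all add: \<tau> l)
    then have "T * (2 / \<rho> * F) = 2 * F * Dz * (l * \<tau>) / Gf"
      unfolding rho \<tau>[symmetric] l[symmetric] unfolding T using Gf_pos Dz_pos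
      by (simp add: field_simps)
    moreover have "sqrt (lamA * lamB * real T) = l * \<tau>"
      unfolding \<tau> l by (rule real_sqrt_mult)
    ultimately show ?thesis using rho_pos by simp
  qed
  finally show ?thesis using first by blast
qed

end
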